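(* Let $G$ be a finite simple graph of order $n$ ($n\geq 2$) and let $S\subseteq V(G)$ with $|S|=\sigma$. Then $$\mathcal{E}(G_S)\geq 2\lambda_1(G_S)-\frac{2\sigma}{n}.$$ Equality is attained if $G_S=K_n^{\sigma}$, where $K_n^{\sigma}$ is the graph obtained by attaching a loop at each of $\sigma$ ($0\leq\sigma\leq n$) chosen vertices of the complete graph $K_n$.
   Context: For a simple graph $G$ of order $n$ and $S\subseteq V(G)$ with $|S|=\sigma$, the self-loop graph $G_S$ is obtained from $G$ by attaching one loop at each vertex of $S$; its adjacency matrix is $A(G_S)=A(G)+\mathfrak{I}_S$, where $\mathfrak{I}_S$ is the diagonal $0/1$ matrix with ones exactly at the positions corresponding to $S$. With $\lambda_1(G_S)\ge\cdots\ge\lambda_n(G_S)$ the eigenvalues of $A(G_S)$, the energy is $\mathcal{E}(G_S)=\sum_{i=1}^n\left|\lambda_i(G_S)-\frac{\sigma}{n}\right|$. *)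

theory Defs
  imports "Graph_Theory.Kuratowski" "Jordan_Normal_Form.Char_Poly"
begin

text \<open>
  A finite simple graph is a \<^locale>\<open>pair_graph\<close>: a finite, loop-free digraph whose arc relation is
  symmetric. Rows and columns of a matrix are indexed by positions in an enumeration \<open>vs\<close> of the
  vertices, that is, a distinct list with \<open>set vs = pverts G\<close>.
\<close>

definition adj_mat :: "'a pair_pre_digraph \<Rightarrow> 'a list \<Rightarrow> real mat" where
  "adj_mat G vs =
     mat (length vs) (length vs) (\<lambda>(i, j). if (vs ! i, vs ! j) \<in> parcs G then 1 else 0)"

definition loop_mat :: "'a set \<Rightarrow> 'a list \<Rightarrow> real mat" where
  "loop_mat S vs =
     mat (length vs) (length vs) (\<lambda>(i, j). if i = j \<and> vs ! i \<in> S then 1 else 0)"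

definition self_loop_adj_mat :: "'a pair_pre_digraph \<Rightarrow> 'a set \<Rightarrow> 'a list \<Rightarrow> real mat" where
  "self_loop_adj_mat G S vs = adj_mat G vs + loop_mat S vs"

text \<open>
  \<open>eigval A i\<close> is the \<open>i\<close>-th largest eigenvalue, counted from \<open>i = 1\<close> and with algebraic
  multiplicity. Only real eigenvalues are listed; for a symmetric matrix these are all of them, so
  \<open>i\<close> ranges over \<open>1..dim_row A\<close>.
\<close>

definition eigval :: "real mat \<Rightarrow> nat \<Rightarrow> real" where
  "eigval A i = rev (sorted_list_of_multiset (proots (char_poly A))) ! (i - 1)"

definition self_loop_energy :: "'a pair_pre_digraph \<Rightarrow> 'a set \<Rightarrow> 'a list \<Rightarrow> real" where
  "self_loop_energy G S vs =
     (\<Sum>i = 1..card (pverts G).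
        \<bar>eigval (self_loop_adj_mat G S vs) i - real (card S) / real (card (pverts G))\<bar>)"

end

theory Submission
  imports Defs "Jordan_Normal_Form.Schur_Decomposition"
begin

text \<open>
  The shifted eigenvalues \<open>\<mu>\<^sub>i = \<lambda>\<^sub>i - \<sigma>/n\<close> sum to zero because the trace is \<open>\<sigma>\<close>, so
  \<open>\<mu>\<^sub>2, \<dots>, \<mu>\<^sub>n\<close> contribute at least \<open>\<bar>\<mu>\<^sub>1\<bar>\<close> to the energy, with equality when they all have
  the same sign. For the complete graph they are nonpositive: two positive eigenvalues would make
  the quadratic form positive definite on a plane, and every plane meets the hyperplane orthogonal
  to the all-ones vector, where the form is nonpositive.
\<close>

section \<open>Trace and real spectrum of symmetric matrices\<close>

lemma symmetric_mat_scalar_prod: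
  fixes A :: "'a::comm_semiring_0 mat"
  assumes "A \<in> carrier_mat n n" "transpose_mat A = A" "x \<in> carrier_vec n" "y \<in> carrier_vec n"
  shows "(A *\<^sub>v x) \<bullet> y = x \<bullet> (A *\<^sub>v y)"
  using transpose_vec_mult_scalar[OF assms(1,4,3)] by (simp add: assms(2))

lemma trace_mult_commute:
  fixes X Y :: "'a::comm_semiring_0 mat"
  assumes "X \<in> carrier_mat n m" "Y \<in> carrier_mat m n"
  shows "(\<Sum>i<n. (X * Y) $$ (i, i)) = (\<Sum>i<m. (Y * X) $$ (i, i))"
proof -
  have "(\<Sum>i<n. (X * Y) $$ (i, i)) = (\<Sum>i<n. \<Sum>j<m. X $$ (i, j) * Y $$ (j, i))"
    using assms by (intro sum.cong) (auto simp: scalar_prod_def lessThan_atLeast0)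
  also have "\<dots> = (\<Sum>j<m. \<Sum>i<n. Y $$ (j, i) * X $$ (i, j))"
    by (subst sum.swap) (simp add: mult.commute)
  also have "\<dots> = (\<Sum>j<m. (Y * X) $$ (j, j))"
    using assms by (intro sum.cong) (auto simp: scalar_prod_def lessThan_atLeast0)
  finally show ?thesis .
qed

text \<open>Schur triangularisation makes \<open>A\<close> similar to a matrix with diagonal
  \<open>es\<close>, and the trace is invariant under similarity because factors of a product may be
  swapped cyclically.\<close>

lemma trace_eq_sum_list_roots:
  fixes A :: "'a::conjugatable_ordered_field mat"
  assumes A: "A \<in> carrier_mat n n" and cp: "char_poly A = (\<Prod>e\<leftarrow>es. [:- e, 1:])"
  shows "(\<Sum>i<n. A $$ (i, i)) = sum_list es"
proof -
  obtain B P Q where schur: "schur_decomposition A es = (B, P, Q)"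
    by (cases "schur_decomposition A es")
  have sim: "similar_mat_wit A B P Q" and diag: "diag_mat B = es"
    using schur_decomposition[OF A cp schur] by auto
  note c = similar_mat_witD2[OF A sim]
  have "(\<Sum>i<n. A $$ (i, i)) = (\<Sum>i<n. (P * (B * Q)) $$ (i, i))"
    using c by simp
  also have "\<dots> = (\<Sum>i<n. ((B * Q) * P) $$ (i, i))"
    using c by (intro trace_mult_commute) auto
  also have "(B * Q) * P = B"
    using c by (simp add: assoc_mult_mat[of _ n n _ n _ n])
  also have "(\<Sum>i<n. B $$ (i, i)) = sum_list es"
    using c(5) unfolding diag[symmetric]
    by (auto simp: diag_mat_def sum_list_sum_nth lessThan_atLeast0)
  finally show ?thesis .
qed

text \<open>The polynomial splits over the complex numbers. Symmetry forces every complex root to be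
  real, so the factorization descends along the injective coefficient embedding.\<close>

lemma real_symmetric_char_poly_splits:
  fixes A :: "real mat"
  assumes A: "A \<in> carrier_mat n n" and sym: "transpose_mat A = A"
  obtains es where "char_poly A = (\<Prod>e\<leftarrow>es. [:- e, 1:])" "length es = n"
proof -
  interpret h: inj_idom_hom complex_of_real
    by unfold_locales auto
  interpret hp: map_poly_inj_idom_hom complex_of_real ..
  define C where "C = map_mat complex_of_real A"
  have C: "C \<in> carrier_mat n n" and symC: "transpose_mat C = C"
    using A sym by (auto simp: C_def map_mat_transpose)
  obtain as where as: "char_poly C = (\<Prod>a\<leftarrow>as. [:- a, 1:])" "length as = n"
    using char_poly_factorized[OF C] by auto
  have real: "complex_of_real (Re a) = a" if "a \<in> set as" for a
  proof -
    have "poly (char_poly C) a = 0"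
      using that by (auto simp: as poly_prod_list prod_list_zero_iff)
    then obtain v where v: "v \<in> carrier_vec n" "v \<noteq> 0\<^sub>v n" and ev: "C *\<^sub>v v = a \<cdot>\<^sub>v v"
      using eigenvalue_root_char_poly[OF C] C by (auto simp: eigenvalue_def eigenvector_def)
    have cv: "conjugate v \<in> carrier_vec n"
      using v by simp
    \<comment> \<open>The entries of \<open>C\<close> are real, so conjugation passes through the
      product.\<close>
    have "C *\<^sub>v conjugate v = conjugate (C *\<^sub>v v)"
      using A v by (intro eq_vecI) (auto simp: C_def scalar_prod_def)
    then have evc: "C *\<^sub>v conjugate v = cnj a \<cdot>\<^sub>v conjugate v"
      by (simp add: ev conjugate_smult_vec)
    \<comment> \<open>Moving the symmetric \<open>C\<close> from one argument to the other evaluates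
      the same product with eigenvalue \<open>a\<close> and with eigenvalue
      \<open>cnj a\<close>.\<close>
    have "a * (v \<bullet>c v) = cnj a * (v \<bullet>c v)"
      using symmetric_mat_scalar_prod[OF C symC v(1) cv] v(1) cv by (simp add: ev evc)
    moreover have "v \<bullet>c v \<noteq> 0"
      using v by simp
    ultimately have "a = cnj a"
      by simp
    then show ?thesis
      by (metis Reals_cnj_iff of_real_Re)
  qed
  have "map_poly complex_of_real (char_poly A) = char_poly C"
    unfolding C_def by (rule of_real_hom.char_poly_hom[OF A, symmetric])
  also have "\<dots> = (\<Prod>a\<leftarrow>as. [:- a, 1:])"
    by (fact as(1))
  also have "\<dots> = (\<Prod>a\<leftarrow>map Re as. map_poly complex_of_real [:- a, 1:])"
    using real by (auto intro!: arg_cong[where f = prod_list])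
  also have "\<dots> = map_poly complex_of_real (\<Prod>a\<leftarrow>map Re as. [:- a, 1:])"
    by (simp add: hp.hom_prod_list o_def)
  finally have "char_poly A = (\<Prod>a\<leftarrow>map Re as. [:- a, 1:])"
    by simp
  with that[of "map Re as"] as show thesis
    by simp
qed

text \<open>\<open>eigval\<close> reads only the real roots. Since the polynomial splits over the
  reals, these are \<open>n\<close> in number, so indices from 1 to \<open>n\<close> never leave the
  list. Its decreasing order is what later places the largest eigenvalues first in a Schur
  form.\<close>

lemma eigval_list:
  fixes A :: "real mat"
  assumes A: "A \<in> carrier_mat n n" and sym: "transpose_mat A = A"
  obtains es where "char_poly A = (\<Prod>e\<leftarrow>es. [:- e, 1:])" "length es = n" "sorted (rev es)"
    "\<And>i. eigval A (Suc i) = es ! i"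
proof -
  obtain as where as: "char_poly A = (\<Prod>a\<leftarrow>as. [:- a, 1:])" "length as = n"
    using real_symmetric_char_poly_splits[OF A sym] .
  define es where "es = rev (sorted_list_of_multiset (proots (char_poly A)))"
  have "proots (\<Prod>a\<leftarrow>as. [:- a, 1:]) = mset as"
  proof (induction as)
    case (Cons a as)
    have "(\<Prod>a\<leftarrow>as. [:- a, 1:]) \<noteq> 0"
      by (auto simp: prod_list_zero_iff)
    then show ?case
      using Cons.IH proots_mult[of "[:- a, 1:]"] by (simp del: mult_pCons_left)
  qed simp
  then have m: "mset es = mset as"
    by (simp add: es_def as)
  then have "prod_mset (image_mset (\<lambda>e. [:- e, 1:]) (mset es)) =
      prod_mset (image_mset (\<lambda>e. [:- e, 1:]) (mset as))"
    by simp
  then have "(\<Prod>e\<leftarrow>es. [:- e, 1:]) = (\<Prod>a\<leftarrow>as. [:- a, 1:])"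
    unfolding mset_map[symmetric] prod_mset_prod_list .
  with as have "char_poly A = (\<Prod>e\<leftarrow>es. [:- e, 1:])"
    by simp
  moreover have "length es = n"
    using m as by (metis size_mset)
  ultimately show thesis
    using that by (simp add: es_def eigval_def sorted_sorted_list_of_multiset)
qed

lemma eigval_antimono:
  fixes A :: "real mat"
  assumes "A \<in> carrier_mat n n" "transpose_mat A = A" "1 \<le> i" "i \<le> j" "j \<le> n"
  shows "eigval A j \<le> eigval A i"
proof -
  obtain es where es: "length es = n" "sorted (rev es)" "\<And>i. eigval A (Suc i) = es ! i"
    using eigval_list[OF assms(1,2)] by metis
  show ?thesis
    using sorted_rev_nth_mono[OF es(2), of "i - 1" "j - 1"] assms es(1) es(3)[of "i - 1"]
      es(3)[of "j - 1"] by simp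
qed

lemma sum_eigval:
  fixes A :: "real mat"
  assumes "A \<in> carrier_mat n n" "transpose_mat A = A"
  shows "(\<Sum>i = 1..n. eigval A i) = (\<Sum>i<n. A $$ (i, i))"
proof -
  obtain es where es: "char_poly A = (\<Prod>e\<leftarrow>es. [:- e, 1:])" "length es = n"
    "\<And>i. eigval A (Suc i) = es ! i"
    using eigval_list[OF assms] by metis
  have "(\<Sum>i = 1..n. eigval A i) = (\<Sum>i<n. eigval A (Suc i))"
    by (simp add: lessThan_atLeast0 sum.shift_bounds_Suc_ivl[symmetric] atLeastLessThanSuc_atLeastAtMost
        del: sum.op_ivl_Suc)
  also have "\<dots> = sum_list es"
    by (simp add: es sum_list_sum_nth lessThan_atLeast0)
  finally show ?thesis
    using trace_eq_sum_list_roots[OF assms(1) es(1)] by simp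
qed

section \<open>Quadratic forms and the second largest eigenvalue\<close>

text \<open>A Schur form with decreasing diagonal has its first two basis vectors spanning an
  invariant plane. Orthogonalising them and using symmetry removes the off-diagonal entry. This also
  covers a repeated top eigenvalue, where distinctness could not supply orthogonality.\<close>

lemma orthogonal_top_eigenvectors:
  fixes A :: "real mat"
  assumes A: "A \<in> carrier_mat n n" and sym: "transpose_mat A = A" and n: "2 \<le> n"
  obtains p q where "p \<in> carrier_vec n" "q \<in> carrier_vec n" "p \<noteq> 0\<^sub>v n" "q \<noteq> 0\<^sub>v n" "p \<bullet> q = 0"
    "A *\<^sub>v p = eigval A 1 \<cdot>\<^sub>v p" "A *\<^sub>v q = eigval A 2 \<cdot>\<^sub>v q"
proof -
  obtain es where es: "char_poly A = (\<Prod>e\<leftarrow>es. [:- e, 1:])" "length es = n"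
    "\<And>i. eigval A (Suc i) = es ! i"
    using eigval_list[OF A sym] by metis
  obtain B P Q where schur: "schur_decomposition A es = (B, P, Q)"
    by (cases "schur_decomposition A es")
  have sim: "similar_mat_wit A B P Q" and upper: "upper_triangular B" and diag: "diag_mat B = es"
    using schur_decomposition[OF A es(1) schur] by auto
  note c = similar_mat_witD2[OF A sim]
  have B: "B $$ (0, 0) = eigval A 1" "B $$ (1, 1) = eigval A 2"
    using c(5) n es(3)[of 0] es(3)[of 1] unfolding diag[symmetric]
    by (auto simp: diag_mat_def numeral_2_eq_2)
  have AP: "A * P = P * B"
    using c by (simp add: assoc_mult_mat[of _ n n _ n _ n])
  define p where "p = col P 0"
  define r where "r = col P 1"
  define b where "b = B $$ (0, 1)"
  have pr: "p \<in> carrier_vec n" "r \<in> carrier_vec n"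
    using c(6) n by (auto simp: p_def r_def)
  \<comment> \<open>\<open>Q\<close> inverts \<open>P\<close>; these images serve to show that
    \<open>p\<close> and, later, \<open>q\<close> are nonzero.\<close>
  have Qp: "Q *\<^sub>v p = unit_vec n 0" and Qr: "Q *\<^sub>v r = unit_vec n 1"
    using c n col_mult2[OF c(7,6), of 0] col_mult2[OF c(7,6), of 1]
    by (auto simp: p_def r_def)
  have colB0: "col B 0 = eigval A 1 \<cdot>\<^sub>v unit_vec n 0"
    using c(5) n upper B by (intro eq_vecI) (auto simp: upper_triangular_def unit_vec_def)
  have colB1: "col B 1 = b \<cdot>\<^sub>v unit_vec n 0 + eigval A 2 \<cdot>\<^sub>v unit_vec n 1"
  proof (rule eq_vecI)
    fix i assume "i < dim_vec (b \<cdot>\<^sub>v unit_vec n 0 + eigval A 2 \<cdot>\<^sub>v unit_vec n 1)"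
    moreover have "i = 0 \<or> i = 1 \<or> 1 < i"
      by auto
    ultimately show "col B 1 $ i = (b \<cdot>\<^sub>v unit_vec n 0 + eigval A 2 \<cdot>\<^sub>v unit_vec n 1) $ i"
      using c(5) n upper B by (auto simp: upper_triangular_def unit_vec_def b_def)
  qed (use c(5) in auto)
  have Pu: "P *\<^sub>v unit_vec n 0 = p" "P *\<^sub>v unit_vec n 1 = r"
    using c(6) n using col_mult2[OF c(6) one_carrier_mat, of 0] col_mult2[OF c(6) one_carrier_mat, of 1]
    by (simp_all add: p_def r_def)
  have Ap: "A *\<^sub>v p = eigval A 1 \<cdot>\<^sub>v p"
    using col_mult2[OF A c(6), of 0] col_mult2[OF c(6,5), of 0] n c(6) AP
    by (simp add: colB0 Pu mult_mat_vec[OF c(6)] flip: p_def)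
  have Ar: "A *\<^sub>v r = b \<cdot>\<^sub>v p + eigval A 2 \<cdot>\<^sub>v r"
    using col_mult2[OF A c(6), of 1] col_mult2[OF c(6,5), of 1] n c(6) AP
    by (simp add: colB1 Pu mult_add_distrib_mat_vec[OF c(6)] mult_mat_vec[OF c(6)]
        del: One_nat_def flip: r_def)
  have Q0: "Q *\<^sub>v 0\<^sub>v n = 0\<^sub>v n"
    using c(7) by (intro eq_vecI) auto
  have p0: "p \<noteq> 0\<^sub>v n"
  proof
    assume "p = 0\<^sub>v n"
    then have "unit_vec n 0 = (0\<^sub>v n :: real vec)"
      using Qp Q0 by simp
    then show False
      using n by simp
  qed
  then have pp: "p \<bullet> p \<noteq> 0"
    using pr conjugate_square_eq_0_vec[of p n] by (simp add: conjugate_vec_def)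
  \<comment> \<open>Gram-Schmidt coefficient: \<open>q\<close> is \<open>r\<close> minus its
    projection onto \<open>p\<close>.\<close>
  define t where "t = (p \<bullet> r) / (p \<bullet> p)"
  define q where "q = r + (- t) \<cdot>\<^sub>v p"
  \<comment> \<open>The coefficient of \<open>p\<close> in \<open>A *\<^sub>v q\<close>, found by
    substituting \<open>r = q + t p\<close> in the expression for
    \<open>A *\<^sub>v r\<close>.\<close>
  define b' where "b' = b + t * (eigval A 2 - eigval A 1)"
  have q: "q \<in> carrier_vec n"
    using pr by (simp add: q_def)
  have pq: "p \<bullet> q = 0"
    using pr pp by (simp add: q_def t_def scalar_prod_add_distrib[of _ n])
  have q0: "q \<noteq> 0\<^sub>v n"
  proof
    assume "q = 0\<^sub>v n"
    then have "Q *\<^sub>v q = 0\<^sub>v n"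
      using Q0 by simp
    moreover have "Q *\<^sub>v q = unit_vec n 1 + (- t) \<cdot>\<^sub>v unit_vec n 0"
      using c(7) pr by (simp add: q_def mult_add_distrib_mat_vec[OF c(7)] mult_mat_vec[OF c(7)] Qp Qr)
    ultimately have "(unit_vec n 1 + (- t) \<cdot>\<^sub>v unit_vec n 0) $ 1 = (0\<^sub>v n :: real vec) $ 1"
      by simp
    then show False
      using n by simp
  qed
  have Aq: "A *\<^sub>v q = b' \<cdot>\<^sub>v p + eigval A 2 \<cdot>\<^sub>v q"
    using A pr by (intro eq_vecI)
      (auto simp: q_def b'_def mult_add_distrib_mat_vec[OF A] mult_mat_vec[OF A] Ap Ar algebra_simps)
  \<comment> \<open>By symmetry this equals \<open>eigval A 1 * (p \<bullet> q)\<close>, which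
    vanishes.\<close>
  have "b' * (p \<bullet> p) = p \<bullet> (A *\<^sub>v q)"
    using pr q pq by (simp add: Aq scalar_prod_add_distrib[of _ n])
  also have "\<dots> = 0"
    using symmetric_mat_scalar_prod[OF A sym pr(1) q] pr q pq by (simp add: Ap)
  finally have "b' = 0"
    using pp by simp
  then have "A *\<^sub>v q = eigval A 2 \<cdot>\<^sub>v q"
    using pr q by (auto simp: Aq)
  with that[of p q] pr q p0 q0 pq Ap show thesis
    by blast
qed

text \<open>An instance of the Courant-Fischer bound: the hyperplane orthogonal to \<open>u\<close>
  has codimension at most 1, so it meets the plane of the top two eigenvectors in a nonzero
  vector.\<close>

lemma eigval_2_nonpos:
  fixes A :: "real mat"
  assumes A: "A \<in> carrier_mat n n" and sym: "transpose_mat A = A" and n: "2 \<le> n"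
    and u: "u \<in> carrier_vec n"
    and nonpos: "\<And>x. x \<in> carrier_vec n \<Longrightarrow> u \<bullet> x = 0 \<Longrightarrow> x \<bullet> (A *\<^sub>v x) \<le> 0"
  shows "eigval A 2 \<le> 0"
proof (rule ccontr)
  assume "\<not> eigval A 2 \<le> 0"
  then have ev2: "0 < eigval A 2"
    by simp
  then have pos1: "0 < eigval A 1"
    using eigval_antimono[OF A sym, of 1 2] n by simp
  obtain p q where p: "p \<in> carrier_vec n" "p \<noteq> 0\<^sub>v n" and q: "q \<in> carrier_vec n" "q \<noteq> 0\<^sub>v n"
    and pq: "p \<bullet> q = 0" and Ap: "A *\<^sub>v p = eigval A 1 \<cdot>\<^sub>v p" and Aq: "A *\<^sub>v q = eigval A 2 \<cdot>\<^sub>v q"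
    using orthogonal_top_eigenvectors[OF A sym n] by metis
  have pp: "0 < p \<bullet> p" and qq: "0 < q \<bullet> q"
    using p q conjugate_square_greater_0_vec[of p n] conjugate_square_greater_0_vec[of q n]
    by (auto simp: conjugate_vec_def)
  have qp: "q \<bullet> p = 0"
    using pq comm_scalar_prod[OF p(1) q(1)] by simp
  define form where "form a b = (a \<cdot>\<^sub>v p + b \<cdot>\<^sub>v q) \<bullet> (A *\<^sub>v (a \<cdot>\<^sub>v p + b \<cdot>\<^sub>v q))" for a b
  have form: "form a b = a\<^sup>2 * eigval A 1 * (p \<bullet> p) + b\<^sup>2 * eigval A 2 * (q \<bullet> q)" for a b
    using p q A
    by (simp add: form_def mult_add_distrib_mat_vec[OF A] mult_mat_vec[OF A] Ap Aq
        scalar_prod_add_distrib[of _ n] add_scalar_prod_distrib[of _ n] pq qp power2_eq_square)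
  have form_nonpos: "form a b \<le> 0" if "a * (u \<bullet> p) + b * (u \<bullet> q) = 0" for a b
    unfolding form_def using that p q u
    by (intro nonpos) (simp_all add: scalar_prod_add_distrib[of _ n])
  show False
  \<comment> \<open>The common vector is \<open>p\<close> itself if \<open>p\<close> is orthogonal
    to \<open>u\<close>, and otherwise the combination of \<open>p\<close> and \<open>q\<close> with
    coefficients \<open>u \<bullet> q\<close> and \<open>- (u \<bullet> p)\<close>, whose second
    coefficient is nonzero.\<close>
  proof (cases "u \<bullet> p = 0")
    case True
    then have "form 1 0 \<le> 0"
      by (intro form_nonpos) simp
    then show False
      using mult_pos_pos[OF pos1 pp] by (simp add: form)
  next
    case False
    have "form (u \<bullet> q) (- (u \<bullet> p)) \<le> 0"
      by (intro form_nonpos) simp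
    moreover have "0 \<le> (u \<bullet> q)\<^sup>2 * eigval A 1 * (p \<bullet> p)"
      using pos1 pp by simp
    moreover have "0 < (u \<bullet> p)\<^sup>2 * eigval A 2 * (q \<bullet> q)"
      using ev2 qq False by simp
    ultimately show False
      by (simp add: form)
  qed
qed

section \<open>Adjacency matrices of self-loop graphs\<close>

lemma self_loop_adj_mat_carrier: "self_loop_adj_mat G S vs \<in> carrier_mat (length vs) (length vs)"
  by (simp add: self_loop_adj_mat_def adj_mat_def loop_mat_def)

lemma self_loop_adj_mat_index:
  assumes "i < length vs" "j < length vs"
  shows "self_loop_adj_mat G S vs $$ (i, j) =
    (if (vs ! i, vs ! j) \<in> parcs G then 1 else 0) + (if i = j \<and> vs ! i \<in> S then 1 else 0)"
  using assms by (simp add: self_loop_adj_mat_def adj_mat_def loop_mat_def)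

lemma (in pair_sym_digraph) self_loop_adj_mat_symmetric:
  "transpose_mat (self_loop_adj_mat G S vs) = self_loop_adj_mat G S vs"
proof -
  have "(u, v) \<in> parcs G \<longleftrightarrow> (v, u) \<in> parcs G" for u v
    using pair_sym_arcs by (auto simp: symmetric_def dest: symD)
  then show ?thesis
    using self_loop_adj_mat_carrier[of G S vs]
    by (intro eq_matI) (auto simp: self_loop_adj_mat_index)
qed

lemma (in pair_loopfree_digraph) trace_self_loop_adj_mat:
  assumes "distinct vs" "S \<subseteq> set vs"
  shows "(\<Sum>i<length vs. self_loop_adj_mat G S vs $$ (i, i)) = real (card S)"
proof -
  have "(\<Sum>i<length vs. self_loop_adj_mat G S vs $$ (i, i)) =
      (\<Sum>i<length vs. if vs ! i \<in> S then 1 else 0)"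
    using pair_no_loops by (intro sum.cong) (fastforce simp: self_loop_adj_mat_index)+
  also have "\<dots> = (\<Sum>v\<in>set vs. if v \<in> S then 1 else 0)"
    by (rule sum.reindex_bij_betw[OF bij_betw_nth]) (use assms in auto)
  also have "\<dots> = real (card S)"
    using assms(2) by (simp add: sum.If_cases Int_absorb1)
  finally show ?thesis .
qed

text \<open>
  For the complete graph \<open>x\<^sup>T A x = (\<Sum>i. x\<^sub>i)\<^sup>2 - (\<Sum>i: v\<^sub>i \<notin> S. x\<^sub>i\<^sup>2)\<close>, where the first
  square vanishes on the hyperplane orthogonal to the all-ones vector.
\<close>

lemma eigval_2_complete_nonpos:
  assumes arcs: "parcs G = {(u, v). u \<in> set vs \<and> v \<in> set vs \<and> u \<noteq> v}"
    and sym: "transpose_mat (self_loop_adj_mat G S vs) = self_loop_adj_mat G S vs"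
    and vs: "distinct vs" "2 \<le> length vs"
  shows "eigval (self_loop_adj_mat G S vs) 2 \<le> 0"
proof -
  let ?A = "self_loop_adj_mat G S vs" and ?n = "length vs"
  have A: "?A \<in> carrier_mat ?n ?n"
    by (rule self_loop_adj_mat_carrier)
  have row: "(?A *\<^sub>v x) $ i = (\<Sum>j<?n. x $ j) - (if vs ! i \<in> S then 0 else x $ i)"
    if "x \<in> carrier_vec ?n" "i < ?n" for x i
  proof -
    have "(?A *\<^sub>v x) $ i = (\<Sum>j<?n. ?A $$ (i, j) * x $ j)"
      using that A by (auto simp: scalar_prod_def lessThan_atLeast0)
    \<comment> \<open>Every entry of row \<open>i\<close> is 1, except that the diagonal entry is 0
      at a vertex without a loop.\<close>
    also have "\<dots> = (\<Sum>j<?n. x $ j - (if j = i then if vs ! i \<in> S then 0 else x $ i else 0))"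
      using that vs
      by (intro sum.cong) (auto simp: self_loop_adj_mat_index arcs nth_eq_iff_index_eq)
    also have "\<dots> = (\<Sum>j<?n. x $ j) - (if vs ! i \<in> S then 0 else x $ i)"
      using that by (simp add: sum_subtractf)
    finally show ?thesis .
  qed
  show ?thesis
  proof (rule eigval_2_nonpos[OF A sym vs(2)])
    show "vec ?n (\<lambda>_. 1) \<in> carrier_vec ?n"
      by simp
    fix x :: "real vec"
    assume x: "x \<in> carrier_vec ?n" and "vec ?n (\<lambda>_. 1) \<bullet> x = 0"
    then have "(\<Sum>j<?n. x $ j) = 0"
      by (simp add: scalar_prod_def lessThan_atLeast0)
    then have "x \<bullet> (?A *\<^sub>v x) = (\<Sum>i<?n. x $ i * - (if vs ! i \<in> S then 0 else x $ i))"
      using x A row[OF x] by (simp add: scalar_prod_def lessThan_atLeast0 del: index_mult_mat_vec)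
    also have "\<dots> \<le> 0"
      by (intro sum_nonpos) auto
    finally show "x \<bullet> (?A *\<^sub>v x) \<le> 0" .
  qed
qed

section \<open>Energy bound from the shifted eigenvalues\<close>

theorem theorem3p5:
  fixes G :: "'a pair_pre_digraph" and S :: "'a set" and vs :: "'a list" and n \<sigma> :: nat
  assumes "pair_graph G"
    and "card (pverts G) = n" and "n \<ge> 2"
    and "S \<subseteq> pverts G" and "card S = \<sigma>"
    and "distinct vs" and "set vs = pverts G"
  shows "self_loop_energy G S vs
           \<ge> 2 * eigval (self_loop_adj_mat G S vs) 1 - 2 * real \<sigma> / real n
         \<and> (complete_digraph n (with_proj G) \<longrightarrow>
              self_loop_energy G S vs
                = 2 * eigval (self_loop_adj_mat G S vs) 1 - 2 * real \<sigma> / real n)"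
proof -
  interpret pair_graph G
    by fact
  let ?A = "self_loop_adj_mat G S vs"
  have len: "length vs = n"
    using assms distinct_card by metis
  have A: "?A \<in> carrier_mat n n" and sym: "transpose_mat ?A = ?A"
    using self_loop_adj_mat_carrier[of G S vs] self_loop_adj_mat_symmetric by (simp_all add: len)
  define \<mu> where "\<mu> i = eigval ?A i - real \<sigma> / real n" for i
  have split: "(\<Sum>i = 1..n. f i) = f 1 + (\<Sum>i = 2..n. f i)" for f :: "nat \<Rightarrow> real"
    using assms(3) by (simp add: sum.atLeast_Suc_atMost numeral_2_eq_2)
  \<comment> \<open>The \<open>n\<close> shifts by \<open>\<sigma> / n\<close> together cancel the
    trace \<open>\<sigma>\<close>.\<close>
  have "(\<Sum>i = 1..n. \<mu> i) = 0"
    using sum_eigval[OF A sym] trace_self_loop_adj_mat[of vs S] assms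
    by (simp add: \<mu>_def sum_subtractf len)
  then have rest: "(\<Sum>i = 2..n. \<mu> i) = - \<mu> 1"
    using split[of \<mu>] by simp
  have energy: "self_loop_energy G S vs = \<bar>\<mu> 1\<bar> + (\<Sum>i = 2..n. \<bar>\<mu> i\<bar>)"
    using assms split[of "\<lambda>i. \<bar>\<mu> i\<bar>"] by (simp add: self_loop_energy_def \<mu>_def)
  have "\<bar>\<mu> 1\<bar> \<le> (\<Sum>i = 2..n. \<bar>\<mu> i\<bar>)"
    using sum_abs[of \<mu> "{2..n}"] by (simp add: rest)
  then have lower: "2 * \<mu> 1 \<le> self_loop_energy G S vs"
    by (simp add: energy)
  have equal: "self_loop_energy G S vs = 2 * \<mu> 1" if "complete_digraph n (with_proj G)"
  proof -
    have "parcs G = {(u, v). u \<in> set vs \<and> v \<in> set vs \<and> u \<noteq> v}"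
      using that assms(7) by (auto simp: complete_digraph_pair_def)
    then have "eigval ?A 2 \<le> 0"
      using eigval_2_complete_nonpos[of G vs S] sym assms len by simp
    \<comment> \<open>The shift subtracts a nonnegative number, so the sign bound on
      \<open>eigval ?A 2\<close> carries over to all later \<open>\<mu> i\<close>.\<close>
    then have nonpos: "\<mu> i \<le> 0" if "i \<in> {2..n}" for i
      using eigval_antimono[OF A sym, of 2 i] that by (simp add: \<mu>_def order_trans[of _ 0])
    then have "(\<Sum>i = 2..n. \<bar>\<mu> i\<bar>) = \<mu> 1"
      using rest by (simp add: sum_negf)
    \<comment> \<open>This sign turns \<open>\<bar>\<mu> 1\<bar>\<close> into
      \<open>\<mu> 1\<close>, so both parts of the energy equal \<open>\<mu> 1\<close>.\<close>
    moreover have "0 \<le> \<mu> 1"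
      using sum_nonpos[of "{2..n}" \<mu>] nonpos rest by simp
    ultimately show ?thesis
      by (simp add: energy)
  qed
  show ?thesis
    using lower equal by (simp add: \<mu>_def right_diff_distrib)
qed

end
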